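(* Let $n\ge1$ and $k\ge 0$ be integers and $s>0$. Consider the set of $s$-tuples $(\sigma_1,\dots,\sigma_s)$ of permutations of $[n]$ such that $\min(\sigma_i)\subseteq\min(\sigma_{i-1})$ for all $1<i\le s$ and $\sum_{j=1}^s|\min(\sigma_j)|=k+s-1$. The number of such $s$-tuples equals ${n\brack k}^{(s)}$.
   Context: For a permutation $\sigma$ of $[n]$, $\min(\sigma)$ denotes the set of minimal elements of the cycles of $\sigma$ (so $|\min(\sigma)|$ is the number of cycles). The $s$-elementary symmetric polynomial is $E_m^{(s)}(x_1,\dots,x_m')=\sum x_1^{a_1}\cdots x_{m'}^{a_{m'}}$, the sum over all tuples of nonnegative integers with sum $m$ and each $a_i\le s$, with $E_m^{(s)}=0$ for $m<0$. The modular $s$-Stirling numbers of the first kind are defined for $n\ge1$ by ${n\brack k}^{(s)}=((n-1)!)^{s}E_{k-1}^{(s)}\left(1,\tfrac{1}{2},\dots ,\tfrac{1}{n-1}\right)$. *)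

theory Defs
  imports Complex_Main "HOL-Library.FuncSet" "HOL-Combinatorics.Combinatorics"
begin

text \<open>
  Fixed points count as cycles: \<^term>\<open>orbit \<sigma> x\<close> is \<^term>\<open>{x}\<close> when \<^term>\<open>\<sigma> x = x\<close>.
\<close>

definition cycle_mins :: "nat \<Rightarrow> (nat \<Rightarrow> nat) \<Rightarrow> nat set" where
  "cycle_mins n \<sigma> = Min ` (orbit \<sigma> ` {1..n})"

text \<open>
  The polynomial \<open>E\<^sub>m\<^sup>(\<^sup>s\<^sup>)(x\<^sub>1, \<dots>, x\<^sub>r)\<close>, evaluated at \<open>x 1, \<dots>, x r\<close>.
  The degree \<open>m\<close> is an integer; for \<open>m < 0\<close> the sum is empty, hence \<open>0\<close>.
\<close>

definition s_elementary :: "nat \<Rightarrow> int \<Rightarrow> nat \<Rightarrow> (nat \<Rightarrow> 'a) \<Rightarrow> 'a::comm_semiring_1" where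
  "s_elementary s m r x =
     (\<Sum>a \<in> {a \<in> {1..r} \<rightarrow>\<^sub>E {0..s}. int (\<Sum>i = 1..r. a i) = m}. \<Prod>i = 1..r. x i ^ a i)"

text \<open>Only meaningful for \<open>n \<ge> 1\<close>.\<close>

definition modular_stirling1 :: "nat \<Rightarrow> nat \<Rightarrow> nat \<Rightarrow> rat" where
  "modular_stirling1 s n k =
     fact (n - 1) ^ s * s_elementary s (int k - 1) (n - 1) (\<lambda>i. 1 / of_nat i)"

definition nested_perm_tuples :: "nat \<Rightarrow> nat \<Rightarrow> nat \<Rightarrow> (nat \<Rightarrow> nat \<Rightarrow> nat) set" where
  "nested_perm_tuples s n k =
     {\<sigma> \<in> {1..s} \<rightarrow>\<^sub>E {p. p permutes {1..n}}.
        (\<forall>i. 1 < i \<and> i \<le> s \<longrightarrow> cycle_mins n (\<sigma> i) \<subseteq> cycle_mins n (\<sigma> (i - 1))) \<and>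
        (\<Sum>j = 1..s. card (cycle_mins n (\<sigma> j))) = k + s - 1}"

end

theory Submission
  imports Defs
begin

text \<open>
  A permutation of \<open>[n + 1]\<close> arises from one of \<open>[n]\<close> either by adding \<open>n + 1\<close> as a fixed point,
  which makes it a new cycle minimum, or by inserting \<open>n + 1\<close> into a cycle in front of one of the
  \<open>n\<close> elements, which leaves the minima unchanged. Hence the number of permutations of \<open>[n]\<close> with
  set of cycle minima \<open>S\<close> is the product of \<open>i - 1\<close> over \<open>i \<in> [n] - S\<close>. A decreasing chain
  \<open>S\<^sub>1, \<dots>, S\<^sub>s\<close> of subsets containing \<open>1\<close> is encoded by the multiplicities
  \<open>a\<^sub>i = |{j. i + 1 \<in> S\<^sub>j}|\<close> for \<open>1 \<le> i < n\<close>, and contributes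
  \<open>\<Prod>i. i ^ (s - a\<^sub>i) = (n - 1)! ^ s * \<Prod>i. (1 / i) ^ a\<^sub>i\<close>.
\<close>

section \<open>Cycle minima in terms of orbits\<close>

definition perms_with_mins :: "nat \<Rightarrow> nat set \<Rightarrow> (nat \<Rightarrow> nat) set" where
  "perms_with_mins n S = {p. p permutes {1..n} \<and> cycle_mins n p = S}"

lemma finite_perms_with_mins [simp]: "finite (perms_with_mins n S)"
  by (rule finite_subset[OF _ finite_permutations[of "{1..n}"]]) (auto simp: perms_with_mins_def)

text \<open>Elements of a cycle share their orbit, so the minimum of some orbit is an element that
  is least in its own orbit. In this form the minima of two permutations are compared through orbit
  inclusions.\<close>

lemma mem_cycle_mins_iff:
  assumes p: "p permutes {1..n}"
  shows "m \<in> cycle_mins n p \<longleftrightarrow> m \<in> {1..n} \<and> (\<forall>y\<in>orbit p m. m \<le> y)"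
proof -
  have perm: "permutation p"
    using p permutes_imp_permutation by blast
  have self: "x \<in> orbit p x" for x
    by (rule permutation_self_in_orbit[OF perm])
  have fin: "finite (orbit p x)" for x
    by (rule finite_orbit[OF self])
  show ?thesis
  proof
    assume "m \<in> cycle_mins n p"
    then obtain x where x: "x \<in> {1..n}" and m: "m = Min (orbit p x)"
      by (auto simp: cycle_mins_def)
    have mem: "m \<in> orbit p x"
      unfolding m using fin self by (intro Min_in) auto
    have "orbit p m \<subseteq> orbit p x"
      using mem by (auto intro: orbit_trans)
    moreover have "orbit p x \<subseteq> {1..n}"
      by (rule permutes_orbit_subset[OF p x])
    ultimately show "m \<in> {1..n} \<and> (\<forall>y\<in>orbit p m. m \<le> y)"
      using mem fin[of x] unfolding m by (meson Min_le subsetD)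
  next
    assume "m \<in> {1..n} \<and> (\<forall>y\<in>orbit p m. m \<le> y)"
    then have "Min (orbit p m) = m" "m \<in> {1..n}"
      using fin self by (auto intro!: Min_eqI)
    then show "m \<in> cycle_mins n p"
      unfolding cycle_mins_def by force
  qed
qed

lemma cycle_mins_subset: "p permutes {1..n} \<Longrightarrow> cycle_mins n p \<subseteq> {1..n}"
  by (auto simp: mem_cycle_mins_iff)

lemma one_mem_cycle_mins:
  assumes "p permutes {1..n}" "n \<ge> 1"
  shows "1 \<in> cycle_mins n p"
  using assms permutes_orbit_subset[of p "{1..n}" 1] by (auto simp: mem_cycle_mins_iff)

section \<open>Inserting a new largest element\<close>

text \<open>A walk along \<open>q\<close> follows \<open>p\<close>, with detours through
  \<open>Suc n\<close> that re-enter at \<open>b\<close>. The second conjunct is the invariant that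
  carries the induction past \<open>Suc n\<close>.\<close>

lemma orbit_insert_subset:
  assumes p: "p permutes {1..n}" and b: "b \<in> {1..Suc n}"
    and q: "q = transpose (Suc n) b \<circ> p" and x: "x \<in> {1..n}" and y: "y \<in> orbit q x"
  shows "(y \<le> n \<longrightarrow> y \<in> orbit p x) \<and> (y = Suc n \<longrightarrow> b \<in> orbit p x) \<and> y \<in> {1..Suc n}"
  using y
proof (induction rule: orbit.induct)
  case base
  have "p x \<in> {1..n}" "p x \<in> orbit p x"
    using permutes_in_image[OF p] x by (auto intro: orbit.base)
  then show ?case
    using b by (auto simp: q transpose_def)
next
  case (step z)
  show ?case
  proof (cases "z = Suc n")
    case True
    then have "p z = z"
      using p by (intro permutes_not_in) auto
    then have "q z = b"
      using True by (simp add: q)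
    then show ?thesis
      using step True b by auto
  next
    case False
    then have z: "z \<in> orbit p x" "z \<in> {1..n}"
      using step by auto
    then have "p z \<in> orbit p x" "p z \<in> {1..n}"
      using permutes_in_image[OF p] by (auto intro: orbit.step)
    then show ?thesis
      using b by (auto simp: q transpose_def)
  qed
qed

text \<open>Each step of \<open>p\<close> is a step of \<open>q\<close>, unless it leads to
  \<open>b\<close>; it is then replaced by the two steps through \<open>Suc n\<close>.\<close>

lemma orbit_subset_orbit_insert:
  assumes p: "p permutes {1..n}" and b: "b \<in> {1..Suc n}"
    and q: "q = transpose (Suc n) b \<circ> p" and x: "x \<in> {1..n}"
  shows "orbit p x \<subseteq> orbit q x"
proof
  have fix_last: "p (Suc n) = Suc n"
    using p by (intro permutes_not_in) auto
  have image_in: "p z \<in> orbit q x" if z: "z \<in> {1..n}" "q z \<in> orbit q x" for z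
  proof (cases "p z = b")
    case True
    then have "q z = Suc n"
      by (simp add: q)
    then have "q (Suc n) \<in> orbit q x"
      using z orbit.step[of "q z" q x] by simp
    then show ?thesis
      using True by (simp add: q fix_last)
  next
    case False
    moreover have "p z \<in> {1..n}"
      using permutes_in_image[OF p] z by blast
    ultimately have "q z = p z"
      by (auto simp: q transpose_def)
    then show ?thesis
      using z by simp
  qed
  fix y assume "y \<in> orbit p x"
  then show "y \<in> orbit q x"
  proof (induction rule: orbit.induct)
    case base
    show ?case
      by (rule image_in[OF x orbit.base])
  next
    case (step z)
    then have "z \<in> {1..n}"
      using permutes_orbit_subset[OF p x] by blast
    then show ?case
      using step image_in by (simp add: orbit.step)
  qed
qed

text \<open>The orbit of an element of \<open>{1..n}\<close> gains at most \<open>Suc n\<close>,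
  which is too large to affect whether that element is least. \<open>Suc n\<close> itself is least
  in its orbit only as a fixed point, that is, for \<open>b = Suc n\<close>.\<close>

lemma cycle_mins_insert:
  assumes p: "p permutes {1..n}" and b: "b \<in> {1..Suc n}"
  shows "cycle_mins (Suc n) (transpose (Suc n) b \<circ> p) =
    (if b = Suc n then insert (Suc n) (cycle_mins n p) else cycle_mins n p)"
proof -
  define q where "q = transpose (Suc n) b \<circ> p"
  have p': "p permutes {1..Suc n}"
    by (rule permutes_subset[OF p]) auto
  have q: "q permutes {1..Suc n}"
    unfolding q_def using p' b by (intro permutes_compose permutes_swap_id) auto
  have "p (Suc n) = Suc n"
    using p by (intro permutes_not_in) auto
  then have q_last: "q (Suc n) = b"
    by (simp add: q_def)
  have "x \<in> cycle_mins (Suc n) q \<longleftrightarrow> x \<in> cycle_mins n p" if x: "x \<in> {1..n}" for x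
    using x orbit_insert_subset[OF p b q_def x] orbit_subset_orbit_insert[OF p b q_def x]
    unfolding mem_cycle_mins_iff[OF p] mem_cycle_mins_iff[OF q]
    by (metis atLeastAtMost_iff le_SucE le_SucI subsetD)
  moreover have "Suc n \<in> cycle_mins (Suc n) q \<longleftrightarrow> b = Suc n"
  proof
    assume "Suc n \<in> cycle_mins (Suc n) q"
    then show "b = Suc n"
      using b orbit.base[of q "Suc n"] by (auto simp: mem_cycle_mins_iff[OF q] q_last)
  next
    assume "b = Suc n"
    then have "orbit q (Suc n) = {Suc n}"
      using q_last orbit_eq_singleton_iff by metis
    then show "Suc n \<in> cycle_mins (Suc n) q"
      by (simp add: mem_cycle_mins_iff[OF q])
  qed
  moreover have "{1..Suc n} = insert (Suc n) {1..n}"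
    by auto
  ultimately show ?thesis
    using cycle_mins_subset[OF p] cycle_mins_subset[OF q] unfolding q_def[symmetric]
    by (auto split: if_splits)
qed

section \<open>Counting permutations with prescribed cycle minima\<close>

lemma perms_with_mins_Suc:
  assumes S: "S \<subseteq> {1..Suc n}"
  defines "B \<equiv> if Suc n \<in> S then {Suc n} else {1..n}"
  shows "bij_betw (\<lambda>(b, p). transpose (Suc n) b \<circ> p) (B \<times> perms_with_mins n (S - {Suc n}))
    (perms_with_mins (Suc n) S)"
  unfolding bij_betw_def
proof
  show "inj_on (\<lambda>(b, p). transpose (Suc n) b \<circ> p) (B \<times> perms_with_mins n (S - {Suc n}))"
  proof (rule inj_onI, clarify)
    fix b p b' p'
    assume p: "p \<in> perms_with_mins n (S - {Suc n})" "p' \<in> perms_with_mins n (S - {Suc n})"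
      and eq: "transpose (Suc n) b \<circ> p = transpose (Suc n) b' \<circ> p'"
    \<comment> \<open>Since \<open>p\<close> and \<open>p'\<close> fix \<open>Suc n\<close>,
      evaluating the composite there reads off \<open>b\<close>; applying the same transposition
      again then recovers \<open>p\<close>.\<close>
    have "p (Suc n) = Suc n" "p' (Suc n) = Suc n"
      using p permutes_not_in[of _ "{1..n}" "Suc n"] by (simp_all add: perms_with_mins_def)
    then have "b = b'"
      using fun_cong[OF eq, of "Suc n"] by simp
    moreover have "p = transpose (Suc n) b \<circ> (transpose (Suc n) b \<circ> p)"
      by (simp add: fun_eq_iff)
    then have "p = transpose (Suc n) b \<circ> (transpose (Suc n) b' \<circ> p')"
      unfolding eq .
    then have "p = p'"
      using \<open>b = b'\<close> by (simp add: fun_eq_iff)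
    ultimately show "b = b' \<and> p = p'" ..
  qed
  have ins: "insert (Suc n) {1..n} = {1..Suc n}"
    by (simp add: atLeastAtMostSuc_conv)
  have mins: "cycle_mins (Suc n) (transpose (Suc n) b \<circ> p) = S \<longleftrightarrow>
      b \<in> B \<and> cycle_mins n p = S - {Suc n}"
    if p: "p permutes {1..n}" and b: "b \<in> {1..Suc n}" for b p
  proof -
    have "Suc n \<notin> cycle_mins n p"
      using cycle_mins_subset[OF p] by auto
    then show ?thesis
      using b unfolding cycle_mins_insert[OF p b] B_def by auto
  qed
  have B: "B \<subseteq> {1..Suc n}"
    by (auto simp: B_def)
  \<comment> \<open>This decomposition, with \<open>b\<close> the image of \<open>Suc n\<close>,
    gives surjectivity.\<close>
  have perms: "q permutes {1..Suc n} \<longleftrightarrow>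
      (\<exists>b p. q = transpose (Suc n) b \<circ> p \<and> b \<in> {1..Suc n} \<and> p permutes {1..n})" for q
  proof -
    have "q permutes {1..Suc n} \<longleftrightarrow> q \<in> {q. q permutes insert (Suc n) {1..n}}"
      by (simp only: ins mem_Collect_eq)
    also have "\<dots> \<longleftrightarrow>
        (\<exists>b p. q = transpose (Suc n) b \<circ> p \<and> b \<in> {1..Suc n} \<and> p permutes {1..n})"
      by (subst permutes_insert)
        (simp only: ins image_iff Bex_def split_paired_Ex mem_Collect_eq case_prod_conv, blast)
    finally show ?thesis .
  qed
  show "(\<lambda>(b, p). transpose (Suc n) b \<circ> p) ` (B \<times> perms_with_mins n (S - {Suc n})) =
      perms_with_mins (Suc n) S" (is "?f ` ?L = ?R")
  proof (intro equalityI subsetI)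
    fix q assume "q \<in> ?f ` ?L"
    then obtain b p where q: "q = transpose (Suc n) b \<circ> p" and b: "b \<in> B"
      and p: "p permutes {1..n}" "cycle_mins n p = S - {Suc n}"
      by (auto simp: perms_with_mins_def)
    have b': "b \<in> {1..Suc n}"
      using b B by blast
    have "q permutes {1..Suc n}"
      unfolding perms using q b' p(1) by (intro exI conjI)
    moreover have "cycle_mins (Suc n) q = S"
      unfolding q mins[OF p(1) b'] using b p(2) by (rule conjI)
    ultimately show "q \<in> ?R"
      unfolding perms_with_mins_def by (intro CollectI conjI)
  next
    fix q assume "q \<in> ?R"
    then have "q permutes {1..Suc n}" and q_mins: "cycle_mins (Suc n) q = S"
      by (simp_all only: perms_with_mins_def mem_Collect_eq)
    then obtain b p where q_eq: "q = transpose (Suc n) b \<circ> p" and b: "b \<in> {1..Suc n}"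
      and p: "p permutes {1..n}"
      unfolding perms by (elim exE conjE)
    have "b \<in> B \<and> cycle_mins n p = S - {Suc n}"
      using q_mins unfolding q_eq mins[OF p b] .
    then have "(b, p) \<in> ?L"
      using p by (simp only: perms_with_mins_def mem_Sigma_iff mem_Collect_eq simp_thms)
    then show "q \<in> ?f ` ?L"
      by (rule rev_image_eqI) (simp only: q_eq case_prod_conv)
  qed
qed

text \<open>Inserting \<open>i\<close> leaves \<open>i - 1\<close> choices if \<open>i\<close> is
  not to be a minimum and one choice otherwise. If \<open>S\<close> lacks 1 and
  \<open>n \<ge> 1\<close>, the factor at \<open>i = 1\<close> is 0, in accordance with 1 always
  being a minimum.\<close>

lemma card_perms_with_mins:
  "S \<subseteq> {1..n} \<Longrightarrow> card (perms_with_mins n S) = (\<Prod>i\<in>{1..n} - S. i - 1)"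
proof (induction n arbitrary: S)
  case 0
  then have "perms_with_mins 0 S = {id}"
    by (auto simp: perms_with_mins_def cycle_mins_def)
  then show ?case
    by simp
next
  case (Suc n)
  have "S - {Suc n} \<subseteq> {1..n}"
    using Suc.prems by auto
  note IH = Suc.IH[OF this]
  have card: "card (perms_with_mins (Suc n) S) =
      card (if Suc n \<in> S then {Suc n} else {1..n}) * card (perms_with_mins n (S - {Suc n}))"
    using bij_betw_same_card[OF perms_with_mins_Suc[OF Suc.prems]]
    by (simp add: card_cartesian_product)
  show ?case
  proof (cases "Suc n \<in> S")
    case True
    then have "{1..Suc n} - S = {1..n} - (S - {Suc n})"
      by (auto simp: le_Suc_eq)
    then show ?thesis
      using True card IH by simp
  next
    case False
    then have "{1..Suc n} - S = insert (Suc n) ({1..n} - (S - {Suc n}))"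
      by auto
    then show ?thesis
      using False card IH by simp
  qed
qed

section \<open>Decreasing chains of sets and their multiplicities\<close>

text \<open>Decodes multiplicities into the \<open>j\<close>-th set of a chain. The shift by
  \<open>Suc\<close> makes the index \<open>i\<close> equal to the factor that the element
  \<open>Suc i\<close> contributes when it is absent.\<close>

definition chain :: "nat \<Rightarrow> (nat \<Rightarrow> nat) \<Rightarrow> nat \<Rightarrow> nat set" where
  "chain n a j = insert 1 (Suc ` {i \<in> {1..n - 1}. j \<le> a i})"

lemma chain_subset: "n \<ge> 1 \<Longrightarrow> chain n a j \<subseteq> {1..n}"
  by (auto simp: chain_def)

lemma Suc_mem_chain_iff: "Suc i \<in> chain n a j \<longleftrightarrow> i = 0 \<or> i \<in> {1..n - 1} \<and> j \<le> a i"
  by (auto simp: chain_def)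

text \<open>Padding with factors 1 makes the index range independent of \<open>j\<close>, so that
  products over \<open>i\<close> and \<open>j\<close> can later be exchanged.\<close>

lemma prod_complement_chain:
  assumes "n \<ge> 1"
  shows "(\<Prod>i\<in>{1..n} - chain n a j. i - 1) = (\<Prod>i = 1..n - 1. if j \<le> a i then 1 else i)"
proof -
  have "{1..n} - chain n a j = Suc ` {i \<in> {1..n - 1}. \<not> j \<le> a i}"
  proof (rule set_eqI)
    fix x show "x \<in> {1..n} - chain n a j \<longleftrightarrow> x \<in> Suc ` {i \<in> {1..n - 1}. \<not> j \<le> a i}"
      using assms by (cases x) (auto simp: Suc_mem_chain_iff image_iff)
  qed
  then have "(\<Prod>i\<in>{1..n} - chain n a j. i - 1) = (\<Prod>i\<in>{i \<in> {1..n - 1}. \<not> j \<le> a i}. i)"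
    by (simp add: prod.reindex)
  also have "\<dots> = (\<Prod>i = 1..n - 1. if \<not> j \<le> a i then i else 1)"
    by (rule prod.inter_filter) simp
  also have "\<dots> = (\<Prod>i = 1..n - 1. if j \<le> a i then 1 else i)"
    by (rule prod.cong) auto
  finally show ?thesis .
qed

text \<open>Double counting of the pairs \<open>(i, j)\<close> with \<open>j \<le> a i\<close>; the
  element 1, present in all sets, accounts for the summand \<open>s\<close>.\<close>

lemma sum_card_chain:
  assumes "\<And>i. i \<in> {1..n - 1} \<Longrightarrow> a i \<le> s"
  shows "(\<Sum>j = 1..s. card (chain n a j)) = s + (\<Sum>i = 1..n - 1. a i)"
proof -
  have "card (chain n a j) = 1 + (\<Sum>i = 1..n - 1. if j \<le> a i then 1 else 0)" for j
  proof -
    have "card (chain n a j) = 1 + card {i \<in> {1..n - 1}. j \<le> a i}"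
      unfolding chain_def by (subst card_insert_disjoint) (auto simp: card_image)
    also have "card {i \<in> {1..n - 1}. j \<le> a i} = (\<Sum>i = 1..n - 1. if j \<le> a i then 1 else 0)"
      by (subst sum.inter_filter[symmetric]) auto
    finally show ?thesis .
  qed
  then have "(\<Sum>j = 1..s. card (chain n a j)) =
      s + (\<Sum>j = 1..s. \<Sum>i = 1..n - 1. if j \<le> a i then 1 else 0)"
    by (simp only: sum.distrib) simp
  also have "(\<Sum>j = 1..s. \<Sum>i = 1..n - 1. if j \<le> a i then 1 else (0::nat)) =
      (\<Sum>i = 1..n - 1. \<Sum>j = 1..s. if j \<le> a i then 1 else 0)"
    by (rule sum.swap)
  also have "\<dots> = (\<Sum>i = 1..n - 1. a i)"
  proof (rule sum.cong[OF refl])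
    fix i assume i: "i \<in> {1..n - 1}"
    have "(\<Sum>j = 1..s. if j \<le> a i then 1 else (0::nat)) = card {j \<in> {1..s}. j \<le> a i}"
      by (simp add: sum.inter_filter[symmetric])
    also have "{j \<in> {1..s}. j \<le> a i} = {1..a i}"
      using assms[OF i] by auto
    finally show "(\<Sum>j = 1..s. if j \<le> a i then 1 else 0) = a i"
      by simp
  qed
  finally show ?thesis .
qed

text \<open>Descending from the maximum reaches every smaller positive index. It is applied to the
  indices \<open>j\<close> of the sets of a decreasing chain that contain a fixed element.\<close>

lemma initial_segment_cases:
  fixes D :: "nat set"
  assumes D: "D \<subseteq> {1..s}" and down: "\<And>j. j \<in> D \<Longrightarrow> 1 < j \<Longrightarrow> j - 1 \<in> D"
  obtains m where "m \<le> s" "D = {1..m}"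
proof (cases "D = {}")
  case True
  then show ?thesis
    using that[of 0] by simp
next
  case False
  have fin: "finite D"
    using D finite_subset by blast
  have "Max D \<in> D"
    using False fin by simp
  have "x \<in> D" if "x \<le> Max D" "1 \<le> x" for x
    using that
  proof (induction rule: inc_induct)
    case base
    show ?case
      by (rule \<open>Max D \<in> D\<close>)
  next
    case (step m)
    then show ?case
      using down[of "Suc m"] by simp
  qed
  then have "D = {1..Max D}"
    using D fin by auto
  then show ?thesis
    using that \<open>Max D \<in> D\<close> D by (metis atLeastAtMost_iff subsetD)
qed

lemma chain_exists:
  assumes S: "\<And>j. j \<in> {1..s} \<Longrightarrow> S j \<subseteq> {1..n}" "\<And>j. j \<in> {1..s} \<Longrightarrow> 1 \<in> S j"
    and nested: "\<And>j. 1 < j \<Longrightarrow> j \<le> s \<Longrightarrow> S j \<subseteq> S (j - 1)"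
  obtains a where "a \<in> {1..n - 1} \<rightarrow>\<^sub>E {0..s}" "\<And>j. j \<in> {1..s} \<Longrightarrow> S j = chain n a j"
proof -
  \<comment> \<open>The multiplicity of \<open>Suc i\<close> is the length \<open>m i\<close> of the
    initial segment of indices whose sets contain it.\<close>
  have "\<exists>m\<le>s. {j \<in> {1..s}. Suc i \<in> S j} = {1..m}" for i
    by (rule initial_segment_cases[of "{j \<in> {1..s}. Suc i \<in> S j}" s]) (use nested in auto)
  then obtain m where m: "\<And>i. m i \<le> s" "\<And>i. {j \<in> {1..s}. Suc i \<in> S j} = {1..m i}"
    by metis
  have "S j = chain n (restrict m {1..n - 1}) j" if j: "j \<in> {1..s}" for j
  proof (rule set_eqI)
    fix x
    show "x \<in> S j \<longleftrightarrow> x \<in> chain n (restrict m {1..n - 1}) j"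
    proof (cases x)
      case 0
      then show ?thesis
        using S(1)[OF j] by (auto simp: chain_def)
    next
      case (Suc i)
      have "Suc i \<in> S j \<longleftrightarrow> j \<le> m i"
        using m(2)[of i] j by (auto simp: set_eq_iff)
      then show ?thesis
        using S(1)[OF j] S(2)[OF j] Suc by (cases "i = 0") (auto simp: Suc_mem_chain_iff)
    qed
  qed
  moreover have "restrict m {1..n - 1} \<in> {1..n - 1} \<rightarrow>\<^sub>E {0..s}"
    using m(1) by auto
  ultimately show ?thesis
    using that by blast
qed

text \<open>Membership of \<open>Suc i\<close> in the \<open>j\<close>-th set tests
  \<open>j \<le> a i\<close>; as the values are at most \<open>s\<close>, the tests for
  \<open>j\<close> in \<open>{1..s}\<close> determine \<open>a i\<close>.\<close>

lemma chain_inj: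
  assumes a: "a \<in> {1..n - 1} \<rightarrow>\<^sub>E {0..s}" and b: "b \<in> {1..n - 1} \<rightarrow>\<^sub>E {0..s}"
    and eq: "\<And>j. j \<in> {1..s} \<Longrightarrow> chain n a j = chain n b j"
  shows "a = b"
proof (rule PiE_ext[OF a b])
  fix i assume i: "i \<in> {1..n - 1}"
  have "j \<le> a i \<longleftrightarrow> j \<le> b i" if "j \<in> {1..s}" for j
    using eq[OF that] i Suc_mem_chain_iff[of i n a j] Suc_mem_chain_iff[of i n b j] by auto
  moreover have "a i \<le> s" "b i \<le> s"
    using PiE_mem[OF a i] PiE_mem[OF b i] by auto
  ultimately show "a i = b i"
    by (metis atLeastAtMost_iff le_antisym le_0_eq not_less_eq_eq order_refl One_nat_def)
qed

section \<open>Summation over multiplicities\<close>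

text \<open>Tuples are sorted by their chain of minima. Once the chain is fixed, the nesting and sum
  conditions are settled and the permutations are chosen independently.\<close>

lemma nested_perm_tuples_eq_UN:
  assumes n: "n \<ge> 1" and s: "s > 0"
  shows "nested_perm_tuples s n k =
    (\<Union>a \<in> {a \<in> {1..n - 1} \<rightarrow>\<^sub>E {0..s}. int (\<Sum>i = 1..n - 1. a i) = int k - 1}.
       \<Pi>\<^sub>E j\<in>{1..s}. perms_with_mins n (chain n a j))"
    (is "?L = ?R")
proof (intro equalityI subsetI)
  fix \<sigma> assume \<sigma>: "\<sigma> \<in> ?L"
  then have perm: "\<sigma> j permutes {1..n}" if "j \<in> {1..s}" for j
    using that by (auto simp: nested_perm_tuples_def)
  obtain a where a: "a \<in> {1..n - 1} \<rightarrow>\<^sub>E {0..s}"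
    and C: "\<And>j. j \<in> {1..s} \<Longrightarrow> cycle_mins n (\<sigma> j) = chain n a j"
    by (rule chain_exists[of s "\<lambda>j. cycle_mins n (\<sigma> j)" n])
      (use perm cycle_mins_subset one_mem_cycle_mins n \<sigma> in \<open>auto simp: nested_perm_tuples_def\<close>)
  have "s + (\<Sum>i = 1..n - 1. a i) = k + s - 1"
  proof -
    have "(\<Sum>j = 1..s. card (chain n a j)) = k + s - 1"
      using \<sigma> C by (simp add: nested_perm_tuples_def)
    then show ?thesis
      using sum_card_chain[of n a s] a by (auto simp: PiE_iff)
  qed
  \<comment> \<open>As \<open>s > 0\<close>, the subtraction in \<open>k + s - 1\<close> does not
    truncate. For \<open>k = 0\<close> the equation is contradictory, which matches the degree
    -1.\<close>
  then have "int (\<Sum>i = 1..n - 1. a i) = int k - 1"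
    using s by linarith
  moreover have "\<sigma> \<in> (\<Pi>\<^sub>E j\<in>{1..s}. perms_with_mins n (chain n a j))"
    using \<sigma> C perm by (auto simp: nested_perm_tuples_def perms_with_mins_def PiE_iff)
  ultimately show "\<sigma> \<in> ?R"
    using a by blast
next
  fix \<sigma> assume "\<sigma> \<in> ?R"
  then obtain a where a: "a \<in> {1..n - 1} \<rightarrow>\<^sub>E {0..s}"
    and sum: "int (\<Sum>i = 1..n - 1. a i) = int k - 1"
    and \<sigma>: "\<sigma> \<in> (\<Pi>\<^sub>E j\<in>{1..s}. perms_with_mins n (chain n a j))"
    by blast
  have C: "cycle_mins n (\<sigma> j) = chain n a j" "\<sigma> j permutes {1..n}" if "j \<in> {1..s}" for j
    using PiE_mem[OF \<sigma> that] by (auto simp: perms_with_mins_def)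
  have "(\<Sum>j = 1..s. card (cycle_mins n (\<sigma> j))) = s + (\<Sum>i = 1..n - 1. a i)"
    using C a sum_card_chain[of n a s] by (auto simp: PiE_iff)
  also have "\<dots> = k + s - 1"
    using sum by linarith
  finally have card: "(\<Sum>j = 1..s. card (cycle_mins n (\<sigma> j))) = k + s - 1" .
  have "cycle_mins n (\<sigma> i) \<subseteq> cycle_mins n (\<sigma> (i - 1))" if "1 < i" "i \<le> s" for i
  proof -
    have "chain n a i \<subseteq> chain n a (i - 1)"
      unfolding chain_def by (intro insert_mono image_mono Collect_mono) auto
    then show ?thesis
      using that by (subst (1 2) C(1)) auto
  qed
  then show "\<sigma> \<in> ?L"
    using \<sigma> C(2) card by (auto simp: nested_perm_tuples_def PiE_iff)
qed

text \<open>The factor \<open>i\<close> occurs once for each set without \<open>Suc i\<close>, that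
  is, for each \<open>j\<close> with \<open>a i < j \<le> s\<close>. The powers \<open>i ^ s\<close>
  taken out of the product form the power of the factorial.\<close>

lemma card_chain_perms:
  assumes n: "n \<ge> 1" and a: "\<And>i. i \<in> {1..n - 1} \<Longrightarrow> a i \<le> s"
  shows "of_nat (card (\<Pi>\<^sub>E j\<in>{1..s}. perms_with_mins n (chain n a j))) =
    fact (n - 1) ^ s * (\<Prod>i = 1..n - 1. (1 / of_nat i) ^ a i :: rat)"
proof -
  have "card (\<Pi>\<^sub>E j\<in>{1..s}. perms_with_mins n (chain n a j)) =
      (\<Prod>j = 1..s. \<Prod>i = 1..n - 1. if j \<le> a i then 1 else i)"
    by (subst card_PiE)
      (simp_all only: finite_atLeastAtMost card_perms_with_mins[OF chain_subset[OF n]]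
        prod_complement_chain[OF n])
  also have "\<dots> = (\<Prod>i = 1..n - 1. \<Prod>j = 1..s. if j \<le> a i then 1 else i)"
    by (rule prod.swap)
  also have "\<dots> = (\<Prod>i = 1..n - 1. i ^ (s - a i))"
  proof (rule prod.cong[OF refl])
    fix i assume i: "i \<in> {1..n - 1}"
    have "(\<Prod>j = 1..s. if j \<le> a i then 1 else i) = (\<Prod>j = 1..s. if a i < j then i else 1)"
      by (rule prod.cong) auto
    also have "\<dots> = (\<Prod>j\<in>{j \<in> {1..s}. a i < j}. i)"
      by (rule prod.inter_filter[symmetric]) simp
    also have "{j \<in> {1..s}. a i < j} = {a i<..s}"
      using a[OF i] by auto
    finally show "(\<Prod>j = 1..s. if j \<le> a i then 1 else i) = i ^ (s - a i)"
      by simp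
  qed
  finally have "of_nat (card (\<Pi>\<^sub>E j\<in>{1..s}. perms_with_mins n (chain n a j))) =
      (\<Prod>i = 1..n - 1. of_nat i ^ (s - a i) :: rat)"
    by simp
  \<comment> \<open>Here \<open>a i \<le> s\<close> makes \<open>s - a i\<close> a true difference,
    and \<open>i \<ge> 1\<close> permits the division.\<close>
  also have "\<dots> = (\<Prod>i = 1..n - 1. of_nat i ^ s * (1 / of_nat i) ^ a i)"
    using a by (intro prod.cong refl) (auto simp: power_diff power_one_over field_simps)
  also have "\<dots> = fact (n - 1) ^ s * (\<Prod>i = 1..n - 1. (1 / of_nat i) ^ a i)"
    by (simp add: prod.distrib fact_prod prod_power_distrib)
  finally show ?thesis .
qed

theorem theorem5p6:
  fixes n k s :: nat
  assumes "n \<ge> 1" and "s > 0"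
  shows "of_nat (card (nested_perm_tuples s n k)) = modular_stirling1 s n k"
proof -
  define A where "A = {a \<in> {1..n - 1} \<rightarrow>\<^sub>E {0..s}. int (\<Sum>i = 1..n - 1. a i) = int k - 1}"
  define F where "F a = (\<Pi>\<^sub>E j\<in>{1..s}. perms_with_mins n (chain n a j))" for a
  have "finite A"
    by (rule finite_subset[of _ "{1..n - 1} \<rightarrow>\<^sub>E {0..s}"]) (auto simp: A_def intro: finite_PiE)
  moreover have "finite (F a)" for a
    by (auto simp: F_def intro: finite_PiE)
  \<comment> \<open>A common tuple would have both chains as its sets of minima, and the chain
    determines the multiplicities.\<close>
  moreover have "F a \<inter> F b = {}" if "a \<in> A" "b \<in> A" "a \<noteq> b" for a b
  proof (rule ccontr)
    assume "F a \<inter> F b \<noteq> {}"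
    then obtain \<sigma> where "\<sigma> \<in> F a" "\<sigma> \<in> F b"
      by blast
    then have "chain n a j = chain n b j" if "j \<in> {1..s}" for j
      using that by (fastforce simp: F_def perms_with_mins_def PiE_iff)
    then show False
      using chain_inj[of a n s b] that by (auto simp: A_def)
  qed
  ultimately have "card (nested_perm_tuples s n k) = (\<Sum>a\<in>A. card (F a))"
    unfolding nested_perm_tuples_eq_UN[OF assms] A_def[symmetric] F_def[symmetric]
    by (intro card_UN_disjoint) auto
  then have "of_nat (card (nested_perm_tuples s n k)) = (\<Sum>a\<in>A. of_nat (card (F a)) :: rat)"
    by simp
  also have "\<dots> = (\<Sum>a\<in>A. fact (n - 1) ^ s * (\<Prod>i = 1..n - 1. (1 / of_nat i) ^ a i))"
    unfolding F_def
    by (intro sum.cong refl card_chain_perms[OF assms(1)]) (auto simp: A_def PiE_iff)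
  \<comment> \<open>\<open>A\<close> is the index set of \<open>s_elementary\<close> in degree
    \<open>k - 1\<close> with \<open>n - 1\<close> variables, so only the constant factor has to be
    moved out of the sum.\<close>
  also have "\<dots> = modular_stirling1 s n k"
    by (simp add: modular_stirling1_def s_elementary_def A_def sum_distrib_left)
  finally show ?thesis .
qed

end
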